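(* Let $M$ be a compact metric space, let $f_1,\dots,f_k\colon M\to M$ be continuous maps, and let $F\colon \Sigma_k\times M\to\Sigma_k\times M$, $F(\vartheta,x)=(\sigma(\vartheta),f_{\vartheta_0}(x))$, be the step skew product with fiber maps $f_1,\dots,f_k$. Assume that $S_F\neq\emptyset$. Then: (1) For every disjunctive point $z\in\Sigma_k\times M$ one has $\overline{\mathrm{graph}\,\rho}\subset\omega_F(z)$. Moreover, if either $\overline{A_F}$ is a Lyapunov stable fixed point of the Barnsley-Hutchinson operator $\mathcal{B}_F$, or $\overline{A_F}$ has nonempty interior (in $M$), then $\overline{\mathrm{graph}\,\rho}=\omega_F(z)$ for every disjunctive point $z$. (2) $\Lambda_{F_A}=\overline{\mathrm{graph}\,\rho}$. (3) $F$ is topologically mixing in $\overline{\mathrm{graph}\,\rho}$.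
   Context: $\Sigma_k=\{1,\dots,k\}^{\mathbb{Z}}$ carries the product topology, and $\sigma$ is the (left) shift map on it. The set of weakly hyperbolic sequences is $S_F=\{\vartheta\in\Sigma_k:\ \bigcap_{n\ge 0} f_{\vartheta_{-1}}\circ\cdots\circ f_{\vartheta_{-n}}(M)\text{ is a singleton}\}$. The coding map is $\rho\colon S_F\to M$, $\rho(\vartheta)=\lim_{n\to\infty} f_{\vartheta_{-1}}\circ\cdots\circ f_{\vartheta_{-n}}(p)$, where the limit exists and does not depend on $p\in M$. Its graph is $\mathrm{graph}\,\rho=\{(\vartheta,\rho(\vartheta)):\vartheta\in S_F\}$, and the target set is $A_F=\rho(S_F)$. The set $\Sigma_k\times\overline{A_F}$ is mapped into itself by $F$; $F_A$ denotes the restriction of $F$ to $\Sigma_k\times\overline{A_F}$, and $\Lambda_{F_A}=\bigcap_{n\ge0}F_A^n(\Sigma_k\times\overline{A_F})$ is its maximal attractor. A sequence $\vartheta\in\Sigma_k$ is disjunctive if its forward $\sigma$-orbit is dense in $\Sigma_k$; a point $z=(\vartheta,x)$ is disjunctive if $\vartheta$ is disjunctive. $\omega_F(z)$ is the $\omega$-limit set of $z$: the set of points $(\eta,y)$ for which there is a sequence $n_j\to\infty$ with $F^{n_j}(z)\to(\eta,y)$. The Barnsley-Hutchinson operator is $\mathcal{B}_F(A)=\bigcup_{i=1}^k f_i(A)$ for $A\subset M$. A fixed point $A$ of $\mathcal{B}_F$ is Lyapunov stable if for every open neighborhood $V$ of $A$ there is an open neighborhood $V_0$ of $A$ such that $\mathcal{B}_F^n(V_0)\subset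 V$ for every $n\ge0$. For a compact $F$-invariant set $Y\subset\Sigma_k\times M$, $F$ is topologically mixing in $Y$ if for every pair of nonempty relatively open subsets $U,V$ of $Y$ there is $n_0$ such that $F^n(V)\cap U\neq\emptyset$ for all $n\ge n_0$. *)

theory Defs
  imports "HOL-Analysis.Analysis"
begin

(* The type int => nat carries the product topology of Function_Topology, with nat discrete.
   Both full_shift k and (for compact M) full_shift k \<times> M are closed in their ambient types,
   so closures of subsets and limits of sequences may be taken in the ambient type. *)

definition full_shift :: "nat \<Rightarrow> (int \<Rightarrow> nat) set" where
  "full_shift k = {\<theta>. \<forall>i. \<theta> i \<in> {1..k}}"

definition left_shift :: "(int \<Rightarrow> nat) \<Rightarrow> (int \<Rightarrow> nat)" where
  "left_shift \<theta> = (\<lambda>i. \<theta> (i + 1))"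

definition skew_product :: "(nat \<Rightarrow> 'a \<Rightarrow> 'a) \<Rightarrow> (int \<Rightarrow> nat) \<times> 'a \<Rightarrow> (int \<Rightarrow> nat) \<times> 'a" where
  "skew_product f = (\<lambda>(\<theta>, x). (left_shift \<theta>, f (\<theta> 0) x))"

(* past_comp f \<theta> n = f (\<theta> (-1)) \<circ> ... \<circ> f (\<theta> (-n)) *)
primrec past_comp :: "(nat \<Rightarrow> 'a \<Rightarrow> 'a) \<Rightarrow> (int \<Rightarrow> nat) \<Rightarrow> nat \<Rightarrow> 'a \<Rightarrow> 'a" where
  "past_comp f \<theta> 0 = id"
| "past_comp f \<theta> (Suc n) = past_comp f \<theta> n \<circ> f (\<theta> (- int (Suc n)))"

definition weakly_hyperbolic :: "nat \<Rightarrow> 'a set \<Rightarrow> (nat \<Rightarrow> 'a \<Rightarrow> 'a) \<Rightarrow> (int \<Rightarrow> nat) set" where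
  "weakly_hyperbolic k M f =
     {\<theta> \<in> full_shift k. is_singleton (\<Inter>n. past_comp f \<theta> n ` M)}"

(* Meaningful on weakly_hyperbolic k M f only: there the limit exists for every p in M
   and does not depend on p. *)
definition coding_map ::
    "'a::metric_space set \<Rightarrow> (nat \<Rightarrow> 'a \<Rightarrow> 'a) \<Rightarrow> (int \<Rightarrow> nat) \<Rightarrow> 'a" where
  "coding_map M f \<theta> = (THE x. \<forall>p\<in>M. (\<lambda>n. past_comp f \<theta> n p) \<longlonglongrightarrow> x)"

definition coding_graph ::
    "nat \<Rightarrow> 'a::metric_space set \<Rightarrow> (nat \<Rightarrow> 'a \<Rightarrow> 'a) \<Rightarrow> ((int \<Rightarrow> nat) \<times> 'a) set" where
  "coding_graph k M f = (\<lambda>\<theta>. (\<theta>, coding_map M f \<theta>)) ` weakly_hyperbolic k M f"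

definition target_set :: "nat \<Rightarrow> 'a::metric_space set \<Rightarrow> (nat \<Rightarrow> 'a \<Rightarrow> 'a) \<Rightarrow> 'a set" where
  "target_set k M f = coding_map M f ` weakly_hyperbolic k M f"

definition disjunctive :: "nat \<Rightarrow> (int \<Rightarrow> nat) \<Rightarrow> bool" where
  "disjunctive k \<theta> \<longleftrightarrow>
     \<theta> \<in> full_shift k \<and> full_shift k \<subseteq> closure (range (\<lambda>n. (left_shift ^^ n) \<theta>))"

definition omega_limit :: "('b::topological_space \<Rightarrow> 'b) \<Rightarrow> 'b \<Rightarrow> 'b set" where
  "omega_limit F z =
     {w. \<exists>r :: nat \<Rightarrow> nat. filterlim r at_top sequentially \<and> (\<lambda>j. (F ^^ r j) z) \<longlonglongrightarrow> w}"

definition maximal_attractor :: "('b \<Rightarrow> 'b) \<Rightarrow> 'b set \<Rightarrow> 'b set" where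
  "maximal_attractor G X = (\<Inter>n. (G ^^ n) ` X)"

definition barnsley_hutchinson :: "nat \<Rightarrow> (nat \<Rightarrow> 'a \<Rightarrow> 'a) \<Rightarrow> 'a set \<Rightarrow> 'a set" where
  "barnsley_hutchinson k f A = (\<Union>i\<in>{1..k}. f i ` A)"

definition lyapunov_stable_fixed_point ::
    "'a::topological_space set \<Rightarrow> ('a set \<Rightarrow> 'a set) \<Rightarrow> 'a set \<Rightarrow> bool" where
  "lyapunov_stable_fixed_point M B A \<longleftrightarrow>
     A \<subseteq> M \<and> B A = A \<and>
     (\<forall>V. openin (top_of_set M) V \<and> A \<subseteq> V \<longrightarrow>
        (\<exists>V0. openin (top_of_set M) V0 \<and> A \<subseteq> V0 \<and> (\<forall>n. (B ^^ n) V0 \<subseteq> V)))"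

(* Forward invariance suffices: together with the mixing clause it gives F ` Y = Y. *)
definition topologically_mixing_in :: "('b::topological_space \<Rightarrow> 'b) \<Rightarrow> 'b set \<Rightarrow> bool" where
  "topologically_mixing_in F Y \<longleftrightarrow>
     compact Y \<and> F ` Y \<subseteq> Y \<and>
     (\<forall>U V. openin (top_of_set Y) U \<and> U \<noteq> {} \<and> openin (top_of_set Y) V \<and> V \<noteq> {} \<longrightarrow>
        (\<exists>n0. \<forall>n\<ge>n0. (F ^^ n) ` V \<inter> U \<noteq> {}))"

end

theory Submission
  imports Defs
begin

text \<open>
  Everything rests on one mechanism. If \<open>\<eta>\<close> is weakly hyperbolic, the compact sets
  \<open>past_comp f \<eta> n ` M\<close> decrease to the point \<open>\<rho> \<eta>\<close>, so some finite word in the past of \<open>\<eta>\<close> already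
  sends all of \<open>M\<close> into a given neighbourhood of \<open>\<rho> \<eta>\<close>. An orbit that has just read this word is
  therefore close to \<open>\<rho> \<eta>\<close>, wherever it started (\<open>orbit_near_coding_graph\<close>). Moreover weak
  hyperbolicity is decided by the remote past alone: recent symbols may be inserted and the future
  replaced, with a known effect on \<open>\<rho>\<close> (\<open>coding_map_prepend\<close>). Write \<open>\<Gamma>\<close> for the graph of \<open>\<rho>\<close>
  and \<open>A\<close> for the target set.

  A disjunctive sequence reads every finite word at arbitrarily late times, so the orbit of a
  disjunctive point comes close to each point of \<open>\<Gamma>\<close> infinitely often; this gives
  \<open>closure \<Gamma> \<subseteq> \<omega>(z)\<close>.

  The attractor over \<open>closure A\<close> contains \<open>\<Gamma>\<close>, since \<open>\<rho> \<theta>\<close> is the limit of the images of any one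
  point of \<open>A\<close> along the past of \<open>\<theta>\<close>. Conversely, \<open>(\<theta>, x)\<close> in the attractor means that \<open>x\<close> is, for
  every \<open>n\<close>, the image of some point of \<open>closure A\<close> under the last \<open>n\<close> symbols of \<open>\<theta>\<close>.
  Approximating that point by some \<open>\<rho> \<eta>\<close> and grafting the past of \<open>\<eta>\<close> onto \<open>\<theta>\<close> before time \<open>-n\<close>
  produces a point of \<open>\<Gamma>\<close> near \<open>(\<theta>, x)\<close> (\<open>maximal_attractor_eq_closure_coding_graph\<close>).

  For the reverse inclusion \<open>\<omega>(z) \<subseteq> closure \<Gamma>\<close> it is enough that the fibre coordinate of the orbit
  eventually remains in each neighbourhood of \<open>closure A\<close>: then \<open>\<omega>(z)\<close> lies over \<open>closure A\<close>, and, being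
  strongly invariant (\<open>omega_limit_backward\<close>), it lies in the attractor. The orbit does enter every open
  set that meets \<open>A\<close>. Lyapunov stability keeps it near \<open>closure A\<close> from then on; if \<open>closure A\<close> has
  interior, the orbit enters \<open>closure A\<close> itself, which is forward invariant.

  Mixing is a matter of gluing words: a sequence with the past of one weakly hyperbolic \<open>\<eta>\<close> and a
  late block copied from another one, \<open>\<xi>\<close>, gives a point of \<open>\<Gamma>\<close> close to \<open>(\<eta>, \<rho> \<eta>)\<close> whose orbit
  is close to \<open>(\<xi>, \<rho> \<xi>)\<close> at the prescribed time.
\<close>


section \<open>Symbolic dynamics of the full shift\<close>

lemma in_closure_iff_open: "x \<in> closure X \<longleftrightarrow> (\<forall>W. open W \<and> x \<in> W \<longrightarrow> X \<inter> W \<noteq> {})"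
  unfolding closure_iff_nhds_not_empty by blast

lemma open_coordinate: "open U \<Longrightarrow> open {\<zeta> :: 'i \<Rightarrow> 'b::topological_space. \<zeta> i \<in> U}"
  using open_vimage[OF _ continuous_on_product_coordinates, of U i] by (simp add: vimage_def)

text \<open>
  Separation passes to products because two distinct points differ in some coordinate. The
  discrete alphabet is only a topological space, so the separation axioms are established for
  arbitrary factors; they are taken in ascending order because each arity must be at least as
  general as those of the stronger classes above it.
\<close>

instance "fun" :: (type, t0_space) t0_space
proof
  fix \<theta> \<eta> :: "'a \<Rightarrow> 'b"
  assume "\<theta> \<noteq> \<eta>"
  then obtain i where "\<theta> i \<noteq> \<eta> i"
    by blast
  then obtain U where "open U" "(\<theta> i \<in> U) \<noteq> (\<eta> i \<in> U)"
    using separation_t0 by metis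
  then show "\<exists>U. open U \<and> \<not> (\<theta> \<in> U \<longleftrightarrow> \<eta> \<in> U)"
    by (intro exI[of _ "{\<zeta>. \<zeta> i \<in> U}"]) (simp add: open_coordinate)
qed

instance "fun" :: (type, t1_space) t1_space
proof
  fix \<theta> \<eta> :: "'a \<Rightarrow> 'b"
  assume "\<theta> \<noteq> \<eta>"
  then obtain i where "\<theta> i \<noteq> \<eta> i"
    by blast
  then obtain U where "open U" "\<theta> i \<in> U" "\<eta> i \<notin> U"
    using t1_space by metis
  then show "\<exists>U. open U \<and> \<theta> \<in> U \<and> \<eta> \<notin> U"
    by (intro exI[of _ "{\<zeta>. \<zeta> i \<in> U}"]) (simp add: open_coordinate)
qed

instance "fun" :: (type, t2_space) t2_space
proof
  fix \<theta> \<eta> :: "'a \<Rightarrow> 'b"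
  assume "\<theta> \<noteq> \<eta>"
  then obtain i where "\<theta> i \<noteq> \<eta> i"
    by blast
  then obtain U V where "open U" "open V" "\<theta> i \<in> U" "\<eta> i \<in> V" "U \<inter> V = {}"
    using hausdorff by metis
  then show "\<exists>U V. open U \<and> open V \<and> \<theta> \<in> U \<and> \<eta> \<in> V \<and> U \<inter> V = {}"
    by (intro exI[of _ "{\<zeta>. \<zeta> i \<in> U}"] exI[of _ "{\<zeta>. \<zeta> i \<in> V}"]) (auto simp: open_coordinate)
qed

definition cylinder :: "(int \<Rightarrow> nat) \<Rightarrow> nat \<Rightarrow> (int \<Rightarrow> nat) set" where
  "cylinder \<theta> n = {\<eta>. \<forall>i. \<bar>i\<bar> \<le> int n \<longrightarrow> \<eta> i = \<theta> i}"

lemma self_in_cylinder [simp]: "\<theta> \<in> cylinder \<theta> n"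
  by (simp add: cylinder_def)

lemma open_cylinder: "open (cylinder \<theta> n)"
proof -
  have "cylinder \<theta> n = (\<Inter>i\<in>{- int n..int n}. {\<eta>. \<eta> i \<in> {\<theta> i}})"
    by (auto simp: cylinder_def abs_le_iff)
  moreover have "open {\<eta> :: int \<Rightarrow> nat. \<eta> i \<in> {\<theta> i}}" for i
    by (intro open_coordinate open_discrete)
  ultimately show ?thesis
    by (metis (no_types, lifting) finite_atLeastAtMost_int open_INT)
qed

lemma open_contains_cylinder:
  assumes "open S" "\<theta> \<in> S"
  shows "\<exists>n. cylinder \<theta> n \<subseteq> S"
proof -
  have "openin (product_topology (\<lambda>i. euclidean) UNIV) S"
    using assms by (simp add: open_fun_def)
  from product_topology_open_contains_basis[OF this assms(2)]
  obtain X where X: "\<theta> \<in> (\<Pi>\<^sub>E i\<in>UNIV. X i)" "finite {i. X i \<noteq> UNIV}" "(\<Pi>\<^sub>E i\<in>UNIV. X i) \<subseteq> S"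
    by auto
  obtain n where n: "\<And>i. X i \<noteq> UNIV \<Longrightarrow> nat \<bar>i\<bar> \<le> n"
    using finite_nat_set_iff_bounded_le[of "(\<lambda>i. nat \<bar>i\<bar>) ` {i. X i \<noteq> UNIV}"] X(2) by auto
  have "\<eta> \<in> S" if "\<eta> \<in> cylinder \<theta> n" for \<eta>
  proof -
    have "\<eta> i \<in> X i" for i
    proof (cases "X i = UNIV")
      case False
      then have "\<bar>i\<bar> \<le> int n"
        using n[of i] by linarith
      then show ?thesis
        using that X(1) by (auto simp: cylinder_def PiE_def)
    qed auto
    then show ?thesis
      using X(3) by auto
  qed
  then show ?thesis
    by blast
qed

lemma open_Times_contains_cylinder:
  fixes x :: "'a::topological_space"
  assumes "open W" "(\<theta>, x) \<in> W"
  obtains n V where "open V" "x \<in> V" "cylinder \<theta> n \<times> V \<subseteq> W"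
proof -
  obtain S V where "open S" "open V" "\<theta> \<in> S" "x \<in> V" "S \<times> V \<subseteq> W"
    using open_prod_elim[OF assms] by (metis mem_Sigma_iff)
  then show ?thesis
    using that open_contains_cylinder[of S \<theta>] by (metis Sigma_mono order_refl subset_trans)
qed

lemma cylinder_antimono: "m \<le> n \<Longrightarrow> cylinder \<theta> n \<subseteq> cylinder \<theta> m"
  by (auto simp: cylinder_def)

lemma compact_full_shift: "compact (full_shift k)"
proof -
  have "full_shift k = (\<Pi>\<^sub>E i\<in>UNIV. {1..k})"
    by (auto simp: full_shift_def)
  moreover have "compactin (product_topology (\<lambda>i::int. euclidean) UNIV) (\<Pi>\<^sub>E i\<in>UNIV. {1..k})"
    by (auto simp: compactin_PiE finite_imp_compact)
  ultimately show ?thesis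
    by (metis compactin_euclidean_iff euclidean_product_topology)
qed

lemma full_shift_translate: "\<theta> \<in> full_shift k \<Longrightarrow> (\<lambda>i. \<theta> (i + c)) \<in> full_shift k"
  by (simp add: full_shift_def)

lemma left_shift_funpow: "(left_shift ^^ m) \<theta> = (\<lambda>i. \<theta> (i + int m))"
  by (induction m) (auto simp: left_shift_def algebra_simps)

text \<open>
  Density of the orbit provides one visit to every cylinder. A visit after time \<open>L\<close> is obtained
  from a visit of the orbit to the word moved \<open>L\<close> places to the right.
\<close>

lemma disjunctive_visits_cylinder:
  assumes "disjunctive k \<theta>" "\<eta> \<in> full_shift k"
  shows "\<exists>m\<ge>L. (\<lambda>i. \<theta> (i + int m)) \<in> cylinder \<eta> n"
proof -
  define \<eta>' where "\<eta>' = (\<lambda>i. \<eta> (i + (- int L)))"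
  have "\<eta>' \<in> full_shift k"
    unfolding \<eta>'_def using assms(2) by (rule full_shift_translate)
  then have "\<eta>' \<in> closure (range (\<lambda>m. (left_shift ^^ m) \<theta>))"
    using assms(1) by (auto simp: disjunctive_def)
  then obtain m where "(left_shift ^^ m) \<theta> \<in> cylinder \<eta>' (n + L)"
    using open_cylinder[of \<eta>' "n + L"] self_in_cylinder
    unfolding in_closure_iff_open by blast
  then have m: "\<theta> (i + int m) = \<eta> (i - int L)" if "\<bar>i\<bar> \<le> int (n + L)" for i
    using that by (auto simp: left_shift_funpow cylinder_def \<eta>'_def)
  have "(\<lambda>i. \<theta> (i + int (m + L))) \<in> cylinder \<eta> n"
    unfolding cylinder_def
  proof (intro CollectI allI impI)
    fix i assume "\<bar>i\<bar> \<le> int n"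
    then show "\<theta> (i + int (m + L)) = \<eta> i"
      using m[of "i + int L"] by (simp add: algebra_simps)
  qed
  then show ?thesis
    by (metis le_add2)
qed


section \<open>Iterates of the skew product\<close>

lemma past_comp_cong:
  assumes "\<And>i. - int n \<le> i \<Longrightarrow> i < 0 \<Longrightarrow> \<theta> i = \<eta> i"
  shows "past_comp f \<theta> n = past_comp f \<eta> n"
  using assms by (induction n) simp_all

lemma past_comp_cylinder: "\<theta> \<in> cylinder \<eta> n \<Longrightarrow> past_comp f \<theta> n = past_comp f \<eta> n"
  by (rule past_comp_cong) (auto simp: cylinder_def)

text \<open>
  Reading \<open>m + n\<close> past symbols means reading the \<open>n\<close> older ones first, as the past of the sequence
  shifted back by \<open>m\<close>.
\<close>

lemma past_comp_add:
  "past_comp f \<theta> (m + n) = past_comp f \<theta> m \<circ> past_comp f (\<lambda>i. \<theta> (i - int m)) n"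
proof (induction n)
  case (Suc n)
  have "- int (Suc (m + n)) = - int (Suc n) - int m"
    by simp
  with Suc show ?case
    by (simp only: add_Suc_right past_comp.simps o_assoc)
qed simp

text \<open>
  Seen from time \<open>m\<close>, the symbols that an orbit has read are the past of the shifted sequence. This
  turns statements about orbits into statements about \<open>past_comp\<close>.
\<close>

lemma skew_product_funpow:
  "(skew_product f ^^ m) (\<theta>, x) =
     ((\<lambda>i. \<theta> (i + int m)), past_comp f (\<lambda>i. \<theta> (i + int m)) m x)"
proof (induction m)
  case (Suc m)
  have "past_comp f (\<lambda>i. \<theta> (i + int (Suc m))) (1 + m) =
      f (\<theta> (int m)) \<circ> past_comp f (\<lambda>i. \<theta> (i + int m)) m"
    by (subst past_comp_add) (simp add: algebra_simps)
  then show ?case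
    using Suc by (simp add: skew_product_def left_shift_def algebra_simps)
qed simp

lemma skew_product_funpow_backward:
  "(skew_product f ^^ n) ((\<lambda>i. \<theta> (i - int n)), x) = (\<theta>, past_comp f \<theta> n x)"
  by (simp add: skew_product_funpow)

lemma funpow_invariant: "F ` X \<subseteq> X \<Longrightarrow> z \<in> X \<Longrightarrow> (F ^^ n) z \<in> X"
  by (induction n) auto

text \<open>
  Outside \<open>X\<close> the restricted map is undefined, but iteration from \<open>X\<close> never leaves \<open>X\<close>.
\<close>

lemma funpow_restrict_image:
  assumes "F ` X \<subseteq> X"
  shows "(restrict F X ^^ n) ` X = (F ^^ n) ` X"
proof -
  have "(restrict F X ^^ n) z = (F ^^ n) z" if "z \<in> X" for z
    using funpow_invariant[OF assms that] by (induction n) simp_all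
  then show ?thesis
    by (rule image_cong[OF refl])
qed

text \<open>
  In a first-countable space the sequence of times can be chosen along a countable neighbourhood
  base, so recurrence to each neighbourhood suffices.
\<close>

lemma omega_limit_iff_frequently:
  fixes z :: "'b::first_countable_topology"
  shows "w \<in> omega_limit F z \<longleftrightarrow>
    (\<forall>W. open W \<and> w \<in> W \<longrightarrow> (\<forall>N. \<exists>m\<ge>N. (F ^^ m) z \<in> W))"
proof
  assume "w \<in> omega_limit F z"
  then obtain r where r: "filterlim r at_top sequentially" "(\<lambda>j. (F ^^ r j) z) \<longlonglongrightarrow> w"
    by (auto simp: omega_limit_def)
  show "\<forall>W. open W \<and> w \<in> W \<longrightarrow> (\<forall>N. \<exists>m\<ge>N. (F ^^ m) z \<in> W)"
  proof (intro allI impI)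
    fix W N assume "open W \<and> w \<in> W"
    then have "eventually (\<lambda>j. (F ^^ r j) z \<in> W) sequentially"
      using r(2) by (auto dest: topological_tendstoD)
    moreover have "eventually (\<lambda>j. N \<le> r j) sequentially"
      using r(1) by (simp add: filterlim_at_top)
    ultimately have "eventually (\<lambda>j. N \<le> r j \<and> (F ^^ r j) z \<in> W) sequentially"
      by eventually_elim simp
    then obtain j where "N \<le> r j \<and> (F ^^ r j) z \<in> W"
      using eventually_happens'[OF sequentially_bot] by blast
    then show "\<exists>m\<ge>N. (F ^^ m) z \<in> W"
      by blast
  qed
next
  assume *: "\<forall>W. open W \<and> w \<in> W \<longrightarrow> (\<forall>N. \<exists>m\<ge>N. (F ^^ m) z \<in> W)"
  obtain A :: "nat \<Rightarrow> 'b set" where A: "\<And>i. open (A i)" "\<And>i. w \<in> A i"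
      "\<And>S. open S \<Longrightarrow> w \<in> S \<Longrightarrow> eventually (\<lambda>i. A i \<subseteq> S) sequentially"
    by (rule countable_basis_at_decseq) blast
  then have "\<forall>j. \<exists>m\<ge>j. (F ^^ m) z \<in> A j"
    using * by blast
  then obtain r where r: "\<And>j. j \<le> r j" "\<And>j. (F ^^ r j) z \<in> A j"
    by metis
  have "(\<lambda>j. (F ^^ r j) z) \<longlonglongrightarrow> w"
  proof (rule topological_tendstoI)
    fix S assume "open S" "w \<in> S"
    from A(3)[OF this] show "eventually (\<lambda>j. (F ^^ r j) z \<in> S) sequentially"
      by eventually_elim (use r(2) in blast)
  qed
  moreover have "filterlim r at_top sequentially"
    by (rule filterlim_at_top_mono[OF filterlim_ident]) (simp add: r(1))
  ultimately show "w \<in> omega_limit F z"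
    by (auto simp: omega_limit_def)
qed

lemma funpow_image_antimono:
  assumes "F ` X \<subseteq> X" "m \<le> n"
  shows "(F ^^ n) ` X \<subseteq> (F ^^ m) ` X"
proof -
  have "(F ^^ n) x = (F ^^ m) ((F ^^ (n - m)) x)" for x
    using assms(2) by (metis comp_apply funpow_add le_add_diff_inverse)
  then show ?thesis
    using funpow_invariant[OF assms(1)] by (auto simp del: funpow.simps)
qed

lemma continuous_on_funpow:
  assumes "continuous_on X F" "F ` X \<subseteq> X"
  shows "continuous_on X (F ^^ n)"
proof (induction n)
  case (Suc n)
  have "(F ^^ n) ` X \<subseteq> X"
    using funpow_invariant[OF assms(2)] by auto
  with Suc assms(1) show ?case
    by (auto intro!: continuous_on_compose simp del: comp_apply intro: continuous_on_subset)
qed (simp add: id_def)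

text \<open>
  An \<open>\<omega>\<close>-limit set of a compact system is strongly invariant: the points visited \<open>n\<close> steps before
  the approach to \<open>w\<close> accumulate at a preimage of \<open>w\<close> that is again an \<open>\<omega>\<close>-limit point.
\<close>

lemma omega_limit_backward:
  fixes F :: "'b::{first_countable_topology, t2_space} \<Rightarrow> 'b"
  assumes "compact X" "continuous_on X F" "F ` X \<subseteq> X" "z \<in> X" "w \<in> omega_limit F z"
  shows "\<exists>u \<in> omega_limit F z \<inter> X. (F ^^ n) u = w"
proof -
  obtain r where r: "filterlim r at_top sequentially" "(\<lambda>j. (F ^^ r j) z) \<longlonglongrightarrow> w"
    using assms(5) by (auto simp: omega_limit_def)
  have inX: "(F ^^ m) z \<in> X" for m
    using funpow_invariant[OF assms(3,4)] .
  obtain u s where u: "u \<in> X" and s: "strict_mono s"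
      "((\<lambda>j. (F ^^ (r j - n)) z) \<circ> s) \<longlonglongrightarrow> u"
    using compact_imp_seq_compact[OF assms(1)] inX unfolding seq_compact_def by meson
  have rs: "filterlim (\<lambda>j. r (s j)) at_top sequentially"
    using filterlim_compose[OF r(1) filterlim_subseq[OF s(1)]] .
  have "filterlim (\<lambda>j. r (s j) - n) at_top sequentially"
    using filterlim_compose[OF filterlim_minus_const_nat_at_top rs] .
  then have "u \<in> omega_limit F z"
    using s(2) by (auto simp: omega_limit_def o_def intro!: exI[of _ "\<lambda>j. r (s j) - n"])
  moreover have "(F ^^ n) u = w"
  proof (rule LIMSEQ_unique)
    have "(\<lambda>j. (F ^^ n) ((F ^^ (r (s j) - n)) z)) \<longlonglongrightarrow> (F ^^ n) u"
    proof (rule continuous_on_tendsto_compose[OF continuous_on_funpow[OF assms(2,3)] _ u])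
      show "(\<lambda>j. (F ^^ (r (s j) - n)) z) \<longlonglongrightarrow> u"
        using s(2) by (simp add: o_def)
      show "eventually (\<lambda>j. (F ^^ (r (s j) - n)) z \<in> X) sequentially"
        by (intro always_eventually allI inX)
    qed
    moreover have "eventually (\<lambda>j. n \<le> r (s j)) sequentially"
      using rs by (simp add: filterlim_at_top)
    then have "eventually (\<lambda>j. (F ^^ n) ((F ^^ (r (s j) - n)) z) = (F ^^ r (s j)) z) sequentially"
      by eventually_elim (metis comp_apply funpow_add le_add_diff_inverse)
    ultimately show "(\<lambda>j. (F ^^ r (s j)) z) \<longlonglongrightarrow> (F ^^ n) u"
      by (rule Lim_transform_eventually)
    show "(\<lambda>j. (F ^^ r (s j)) z) \<longlonglongrightarrow> w"
      using LIMSEQ_subseq_LIMSEQ[OF r(2) s(1)] by (simp add: o_def)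
  qed
  ultimately show ?thesis
    using u by blast
qed


section \<open>Weakly hyperbolic sequences\<close>

locale step_skew_product =
  fixes k :: nat and M :: "'a::metric_space set" and f :: "nat \<Rightarrow> 'a \<Rightarrow> 'a"
  assumes compact_M: "compact M"
    and continuous_f: "\<And>i. i \<in> {1..k} \<Longrightarrow> continuous_on M (f i)"
    and self_map_f: "\<And>i. i \<in> {1..k} \<Longrightarrow> f i ` M \<subseteq> M"
    and nonempty: "weakly_hyperbolic k M f \<noteq> {}"
begin

abbreviation "S \<equiv> weakly_hyperbolic k M f"
abbreviation "\<rho> \<equiv> coding_map M f"
abbreviation "A \<equiv> target_set k M f"
abbreviation "\<Gamma> \<equiv> coding_graph k M f"
abbreviation "F \<equiv> skew_product f"

lemma weakly_hyperbolic_full_shift: "\<theta> \<in> S \<Longrightarrow> \<theta> \<in> full_shift k"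
  by (simp add: weakly_hyperbolic_def)

lemma M_nonempty: "M \<noteq> {}"
proof
  assume "M = {}"
  with nonempty show False
    by (auto simp: weakly_hyperbolic_def is_singleton_def)
qed

lemma past_comp_self_map:
  assumes "\<theta> \<in> full_shift k"
  shows "past_comp f \<theta> n ` M \<subseteq> M"
proof (induction n)
  case (Suc n)
  have "f (\<theta> (- int (Suc n))) ` M \<subseteq> M"
    using assms self_map_f by (auto simp only: full_shift_def mem_Collect_eq)
  with Suc show ?case
    by (simp add: image_comp[symmetric]) blast
qed simp

lemma past_comp_continuous:
  assumes "\<theta> \<in> full_shift k"
  shows "continuous_on M (past_comp f \<theta> n)"
proof (induction n)
  case (Suc n)
  have "\<theta> (- int (Suc n)) \<in> {1..k}"
    using assms by (auto simp only: full_shift_def mem_Collect_eq)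
  then show ?case
    unfolding past_comp.simps
    by (intro continuous_on_compose continuous_f continuous_on_subset[OF Suc] self_map_f)
qed (simp add: id_def)

lemma past_comp_image_antimono:
  assumes "\<theta> \<in> full_shift k" "m \<le> n"
  shows "past_comp f \<theta> n ` M \<subseteq> past_comp f \<theta> m ` M"
proof -
  have "past_comp f \<theta> n = past_comp f \<theta> m \<circ> past_comp f (\<lambda>i. \<theta> (i + (- int m))) (n - m)"
    using past_comp_add[of f \<theta> m "n - m"] assms(2) by simp
  then show ?thesis
    using past_comp_self_map[OF full_shift_translate[OF assms(1)], of "- int m" "n - m"]
    by (simp add: image_comp[symmetric]) blast
qed

lemma past_comp_tendsto:
  assumes "\<theta> \<in> full_shift k" "\<And>V. open V \<Longrightarrow> x \<in> V \<Longrightarrow> \<exists>m. past_comp f \<theta> m ` M \<subseteq> V" "p \<in> M"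
  shows "(\<lambda>n. past_comp f \<theta> n p) \<longlonglongrightarrow> x"
proof (rule topological_tendstoI)
  fix V assume "open V" "x \<in> V"
  with assms(2) obtain m where "past_comp f \<theta> m ` M \<subseteq> V"
    by blast
  then show "eventually (\<lambda>n. past_comp f \<theta> n p \<in> V) sequentially"
    using past_comp_image_antimono[OF assms(1), of m] assms(3)
    unfolding eventually_sequentially by blast
qed

text \<open>
  A decreasing sequence of nonempty compact sets has intersection \<open>{x}\<close> exactly when the sets
  shrink into every neighbourhood of \<open>x\<close>. In this form \<open>\<rho>\<close> is accessible to
  arguments with open sets alone.
\<close>

lemma weakly_hyperbolic_coding_iff:
  assumes "\<theta> \<in> full_shift k"
  shows "\<theta> \<in> S \<and> \<rho> \<theta> = x \<longleftrightarrow> (\<forall>V. open V \<and> x \<in> V \<longrightarrow> (\<exists>m. past_comp f \<theta> m ` M \<subseteq> V))"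
    (is "_ \<longleftrightarrow> ?shrink x")
proof -
  let ?K = "\<lambda>n. past_comp f \<theta> n ` M"
  have compact_K: "compact (?K n)" for n
    by (intro compact_continuous_image past_comp_continuous assms compact_M)
  have coding: "\<rho> \<theta> = y" if "?shrink y" for y
    unfolding coding_map_def
  proof (rule the_equality)
    show lim: "\<forall>p\<in>M. (\<lambda>n. past_comp f \<theta> n p) \<longlonglongrightarrow> y"
      using past_comp_tendsto[OF assms] that by simp
    obtain p where "p \<in> M"
      using M_nonempty by blast
    then show "u = y" if "\<forall>p\<in>M. (\<lambda>n. past_comp f \<theta> n p) \<longlonglongrightarrow> u" for u
      using LIMSEQ_unique[OF bspec[OF that] bspec[OF lim]] by simp
  qed
  have shrink: "?shrink y" if "(\<Inter>n. ?K n) = {y}" for y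
  proof (intro allI impI)
    fix V assume V: "open V \<and> y \<in> V"
    show "\<exists>m. ?K m \<subseteq> V"
    proof (rule ccontr)
      assume none: "\<nexists>m. ?K m \<subseteq> V"
      have "(M - V) \<inter> \<Inter> (range ?K) \<noteq> {}"
      proof (rule compact_imp_fip)
        show "compact (M - V)"
          using V compact_M by (simp add: compact_diff)
        show "closed T" if "T \<in> range ?K" for T
          using that compact_K compact_imp_closed by blast
        fix \<F> assume "finite \<F>" "\<F> \<subseteq> range ?K"
        then obtain I where I: "finite I" "\<F> = ?K ` I"
          by (metis finite_subset_image)
        obtain m where m: "\<And>i. i \<in> I \<Longrightarrow> i \<le> m"
          using I(1) unfolding finite_nat_set_iff_bounded_le by auto
        obtain q where "q \<in> ?K m" "q \<notin> V"
          using none by blast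
        moreover have "q \<in> M"
          using past_comp_self_map[OF assms] \<open>q \<in> ?K m\<close> by blast
        moreover have "q \<in> \<Inter> \<F>"
          unfolding I(2) using past_comp_image_antimono[OF assms m] \<open>q \<in> ?K m\<close> by blast
        ultimately show "(M - V) \<inter> \<Inter> \<F> \<noteq> {}"
          by blast
      qed
      with that V show False
        by auto
    qed
  qed
  have singleton: "(\<Inter>n. ?K n) = {x}" if "?shrink x"
  proof (rule set_eqI)
    fix y
    have "x \<in> ?K n" for n
    proof (rule ccontr)
      assume "x \<notin> ?K n"
      then obtain m where "?K m \<subseteq> - ?K n"
        using \<open>?shrink x\<close>[rule_format, of "- ?K n"] compact_imp_closed[OF compact_K[of n]]
        by (auto simp: open_Compl)
      moreover have "?K (max m n) \<subseteq> ?K m" "?K (max m n) \<subseteq> ?K n"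
        by (intro past_comp_image_antimono assms; simp)+
      ultimately show False
        using M_nonempty by fast
    qed
    moreover have "y \<notin> (\<Inter>n. ?K n)" if "y \<noteq> x"
      using \<open>?shrink x\<close>[rule_format, of "- {y}"] that by auto
    ultimately show "y \<in> (\<Inter>n. ?K n) \<longleftrightarrow> y \<in> {x}"
      by auto
  qed
  show ?thesis
  proof
    assume *: "\<theta> \<in> S \<and> \<rho> \<theta> = x"
    then obtain y where y: "(\<Inter>n. ?K n) = {y}"
      by (auto simp: weakly_hyperbolic_def is_singleton_def)
    with shrink coding * show "?shrink x"
      by metis
  next
    assume "?shrink x"
    with coding singleton assms show "\<theta> \<in> S \<and> \<rho> \<theta> = x"
      by (simp add: weakly_hyperbolic_def)
  qed
qed

lemma weakly_hyperbolic_shrink: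
  assumes "\<theta> \<in> S" "open V" "\<rho> \<theta> \<in> V"
  obtains m where "\<And>n. n \<ge> m \<Longrightarrow> past_comp f \<theta> n ` M \<subseteq> V"
proof -
  obtain m where "past_comp f \<theta> m ` M \<subseteq> V"
    using weakly_hyperbolic_coding_iff[of \<theta> "\<rho> \<theta>"] assms weakly_hyperbolic_full_shift by blast
  then show ?thesis
    using that past_comp_image_antimono[OF weakly_hyperbolic_full_shift[OF assms(1)]] by blast
qed

lemma coding_map_tendsto:
  assumes "\<theta> \<in> S" "p \<in> M"
  shows "(\<lambda>n. past_comp f \<theta> n p) \<longlonglongrightarrow> \<rho> \<theta>"
  using past_comp_tendsto[OF weakly_hyperbolic_full_shift[OF assms(1)] _ assms(2)]
    weakly_hyperbolic_coding_iff[OF weakly_hyperbolic_full_shift[OF assms(1)]] assms(1) by blast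

lemma coding_map_in_M:
  assumes "\<theta> \<in> S"
  shows "\<rho> \<theta> \<in> M"
proof -
  obtain p where p: "p \<in> M"
    using M_nonempty by blast
  then have "past_comp f \<theta> n p \<in> M" for n
    using past_comp_self_map weakly_hyperbolic_full_shift[OF assms] by blast
  then show ?thesis
    using closed_sequentially[OF compact_imp_closed[OF compact_M] _ coding_map_tendsto[OF assms p]]
    by blast
qed

text \<open>
  The one structural fact about \<open>S\<close>: the remote past alone decides weak hyperbolicity. Finitely
  many recent symbols may be inserted at will and act on \<open>\<rho>\<close> by the corresponding composition,
  since a continuous map carries small images to small images; the future may be replaced freely.
\<close>

lemma coding_map_prepend:
  assumes "\<eta> \<in> S" "\<zeta> \<in> full_shift k" "\<And>i. i < 0 \<Longrightarrow> \<zeta> (i - int n) = \<eta> i"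
  shows "\<zeta> \<in> S \<and> \<rho> \<zeta> = past_comp f \<zeta> n (\<rho> \<eta>)"
  unfolding weakly_hyperbolic_coding_iff[OF assms(2)]
proof (intro allI impI)
  fix V assume V: "open V \<and> past_comp f \<zeta> n (\<rho> \<eta>) \<in> V"
  obtain T where T: "open T" "T \<inter> M = past_comp f \<zeta> n -` V \<inter> M"
    using past_comp_continuous[OF assms(2)] V unfolding continuous_on_open_invariant by metis
  have "\<rho> \<eta> \<in> T"
    using T(2) V coding_map_in_M[OF assms(1)] by blast
  then obtain m where "past_comp f \<eta> m ` M \<subseteq> T"
    using weakly_hyperbolic_shrink[OF assms(1) T(1)] by (metis order_refl)
  moreover have "past_comp f \<eta> m ` M \<subseteq> M"
    by (intro past_comp_self_map weakly_hyperbolic_full_shift assms(1))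
  moreover have "past_comp f (\<lambda>i. \<zeta> (i - int n)) m = past_comp f \<eta> m"
    by (rule past_comp_cong) (simp add: assms(3))
  ultimately have "past_comp f \<zeta> (n + m) ` M \<subseteq> V"
    using T(2) by (auto simp: past_comp_add)
  then show "\<exists>m. past_comp f \<zeta> m ` M \<subseteq> V" ..
qed

lemma coding_map_same_past:
  assumes "\<eta> \<in> S" "\<zeta> \<in> full_shift k" "\<And>i. i < 0 \<Longrightarrow> \<zeta> i = \<eta> i"
  shows "\<zeta> \<in> S \<and> \<rho> \<zeta> = \<rho> \<eta>"
  using coding_map_prepend[of \<eta> \<zeta> 0] assms by simp


section \<open>The coding graph and the target set\<close>

lemma skew_product_self_map: "F ` (full_shift k \<times> M) \<subseteq> full_shift k \<times> M"
  using self_map_f by (force simp: skew_product_def left_shift_def full_shift_def)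

lemma skew_product_continuous: "continuous_on (full_shift k \<times> M) F"
proof -
  have shift: "continuous_on UNIV left_shift"
    unfolding left_shift_def
    by (rule continuous_on_coordinatewise_then_product) (rule continuous_on_product_coordinates)
  \<comment> \<open>The fibre map is selected by one symbol, which is locally constant in a product of discrete
    spaces.\<close>
  have fibre: "continuous_on (full_shift k \<times> M) (\<lambda>z. f (fst z 0) (snd z))"
    unfolding continuous_on_sequentially o_def
  proof (intro ballI allI impI, elim conjE)
    fix u z assume z: "z \<in> full_shift k \<times> M" and u: "\<forall>n. u n \<in> full_shift k \<times> M" "u \<longlonglongrightarrow> z"
    have "open ({\<eta> :: int \<Rightarrow> nat. \<eta> 0 = fst z 0} \<times> (UNIV :: 'a set))"
      using open_cylinder[of "fst z" 0] by (intro open_Times) (auto simp: cylinder_def)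
    then have "eventually (\<lambda>n. u n \<in> {\<eta>. \<eta> 0 = fst z 0} \<times> UNIV) sequentially"
      by (rule topological_tendstoD[OF u(2)]) (simp add: mem_Times_iff)
    then have same: "eventually (\<lambda>n. f (fst z 0) (snd (u n)) = f (fst (u n) 0) (snd (u n))) sequentially"
      by eventually_elim auto
    have "fst z 0 \<in> {1..k}"
      using z by (auto simp: full_shift_def)
    moreover have "eventually (\<lambda>n. snd (u n) \<in> M) sequentially"
      using u(1) by (intro always_eventually) (auto simp: mem_Times_iff)
    ultimately have "(\<lambda>n. f (fst z 0) (snd (u n))) \<longlonglongrightarrow> f (fst z 0) (snd z)"
      using z u(2)
      by (intro continuous_on_tendsto_compose[OF continuous_f] tendsto_intros) (auto simp: mem_Times_iff)
    then show "(\<lambda>n. f (fst (u n) 0) (snd (u n))) \<longlonglongrightarrow> f (fst z 0) (snd z)"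
      using same by (rule Lim_transform_eventually)
  qed
  have "F = (\<lambda>z. (left_shift (fst z), f (fst z 0) (snd z)))"
    by (auto simp: skew_product_def)
  then show ?thesis
    using fibre
    by (auto intro!: continuous_on_Pair continuous_on_compose2[OF shift] continuous_on_fst continuous_on_id)
qed

lemma compact_phase_space: "compact (full_shift k \<times> M)"
  by (intro compact_Times compact_full_shift compact_M)

lemma coding_graph_subset: "\<Gamma> \<subseteq> full_shift k \<times> M"
  using coding_map_in_M weakly_hyperbolic_full_shift by (auto simp: coding_graph_def)

lemma closure_coding_graph_subset: "closure \<Gamma> \<subseteq> full_shift k \<times> M"
  by (intro closure_minimal coding_graph_subset compact_imp_closed compact_phase_space)

lemma closure_target_set_subset: "closure A \<subseteq> M"
  using coding_map_in_M
  by (intro closure_minimal compact_imp_closed compact_M) (auto simp: target_set_def)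

lemma target_set_invariant:
  assumes "i \<in> {1..k}"
  shows "f i ` A \<subseteq> A"
proof (rule image_subsetI)
  fix x assume "x \<in> A"
  then obtain \<eta> where \<eta>: "\<eta> \<in> S" "x = \<rho> \<eta>"
    by (auto simp: target_set_def)
  \<comment> \<open>The past of \<open>\<eta>\<close> followed by the symbol \<open>i\<close>, which is repeated as an arbitrary future.\<close>
  define \<zeta> where "\<zeta> = (\<lambda>j. if j < - 1 then \<eta> (j + 1) else i)"
  have "\<zeta> \<in> full_shift k"
    using weakly_hyperbolic_full_shift[OF \<eta>(1)] assms by (auto simp: \<zeta>_def full_shift_def)
  then have "\<zeta> \<in> S \<and> \<rho> \<zeta> = past_comp f \<zeta> 1 (\<rho> \<eta>)"
    using \<eta>(1) by (intro coding_map_prepend) (auto simp: \<zeta>_def)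
  moreover have "past_comp f \<zeta> 1 (\<rho> \<eta>) = f i x"
    by (simp add: \<eta>(2) \<zeta>_def)
  ultimately show "f i x \<in> A"
    unfolding target_set_def by (metis image_eqI)
qed

lemma closure_target_set_invariant:
  assumes "i \<in> {1..k}"
  shows "f i ` closure A \<subseteq> closure A"
proof -
  have "continuous_on (closure A) (f i)"
    using continuous_f[OF assms] closure_target_set_subset by (rule continuous_on_subset)
  then show ?thesis
    using target_set_invariant[OF assms] closure_subset
    by (intro image_closure_subset) (auto intro: closure_subset[THEN subsetD])
qed

lemma skew_product_target_invariant:
  "F ` (full_shift k \<times> closure A) \<subseteq> full_shift k \<times> closure A"
  using closure_target_set_invariant
  by (force simp: skew_product_def left_shift_def full_shift_def)

lemma coding_graph_invariant: "F ` \<Gamma> \<subseteq> \<Gamma>"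
proof (rule image_subsetI)
  fix z assume "z \<in> \<Gamma>"
  then obtain \<eta> where \<eta>: "\<eta> \<in> S" "z = (\<eta>, \<rho> \<eta>)"
    by (auto simp: coding_graph_def)
  have "left_shift \<eta> \<in> full_shift k"
    using weakly_hyperbolic_full_shift[OF \<eta>(1)] by (simp add: left_shift_def full_shift_def)
  then have "left_shift \<eta> \<in> S \<and> \<rho> (left_shift \<eta>) = past_comp f (left_shift \<eta>) 1 (\<rho> \<eta>)"
    using \<eta>(1) by (intro coding_map_prepend) (auto simp: left_shift_def)
  then show "F z \<in> \<Gamma>"
    by (auto simp: coding_graph_def \<eta>(2) skew_product_def left_shift_def)
qed

lemma closure_coding_graph_invariant: "F ` closure \<Gamma> \<subseteq> closure \<Gamma>"
proof (rule image_closure_subset)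
  show "continuous_on (closure \<Gamma>) F"
    using skew_product_continuous closure_coding_graph_subset by (rule continuous_on_subset)
qed (use coding_graph_invariant closure_subset in blast)+

text \<open>
  The contraction mechanism behind density and mixing: near \<open>(\<eta>, \<rho> \<eta>)\<close> it suffices to control the
  symbols, because an orbit that has just read a long piece of the past of \<open>\<eta>\<close> has its fibre
  coordinate close to \<open>\<rho> \<eta>\<close>, whatever it was before.
\<close>

lemma orbit_near_coding_graph:
  assumes "\<eta> \<in> S" "open W" "(\<eta>, \<rho> \<eta>) \<in> W"
  obtains n where
    "\<And>\<theta> x m. \<theta> \<in> full_shift k \<Longrightarrow> x \<in> M \<Longrightarrow> n \<le> m \<Longrightarrow>
       (\<lambda>i. \<theta> (i + int m)) \<in> cylinder \<eta> n \<Longrightarrow> (F ^^ m) (\<theta>, x) \<in> W"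
proof -
  obtain N V where V: "open V" "\<rho> \<eta> \<in> V" "cylinder \<eta> N \<times> V \<subseteq> W"
    using open_Times_contains_cylinder[OF assms(2,3)] .
  obtain N' where N': "\<And>n. n \<ge> N' \<Longrightarrow> past_comp f \<eta> n ` M \<subseteq> V"
    using weakly_hyperbolic_shrink[OF assms(1) V(1,2)] by metis
  \<comment> \<open>One length serves both purposes: the word fixes the first coordinate up to \<open>N\<close> and contracts
    the fibre into \<open>V\<close>.\<close>
  define n where "n = max N N'"
  show ?thesis
  proof
    fix \<theta> x m
    assume \<theta>: "\<theta> \<in> full_shift k" and x: "x \<in> M" and m: "n \<le> m"
      and near: "(\<lambda>i. \<theta> (i + int m)) \<in> cylinder \<eta> n"
    let ?\<theta> = "\<lambda>i. \<theta> (i + int m)"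
    have "past_comp f ?\<theta> m x \<in> past_comp f ?\<theta> n ` M"
      using past_comp_image_antimono[OF full_shift_translate[OF \<theta>] m] x by blast
    also have "past_comp f ?\<theta> n = past_comp f \<eta> n"
      by (rule past_comp_cylinder[OF near])
    also have "past_comp f \<eta> n ` M \<subseteq> V"
      by (rule N') (simp add: n_def)
    finally show "(F ^^ m) (\<theta>, x) \<in> W"
      using V(3) near cylinder_antimono[of N n \<eta>] by (auto simp: skew_product_funpow n_def)
  qed
qed


section \<open>The maximal attractor over the target set\<close>

lemma closed_iterated_image_target:
  "closed ((F ^^ n) ` (full_shift k \<times> closure A))"
proof (intro compact_imp_closed compact_continuous_image)
  show "continuous_on (full_shift k \<times> closure A) (F ^^ n)"
    using continuous_on_funpow[OF skew_product_continuous skew_product_self_map]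
    by (rule continuous_on_subset) (intro Sigma_mono order_refl closure_target_set_subset)
  have "compact (closure A)"
    using closed_Int_compact[OF closed_closure compact_M, of A] closure_target_set_subset
    by (simp add: Int_absorb2)
  then show "compact (full_shift k \<times> closure A)"
    by (intro compact_Times compact_full_shift)
qed

text \<open>
  For \<open>\<theta> \<in> S\<close> the shifted sequence \<open>\<sigma>\<^sup>-\<^sup>m \<theta>\<close> need not be weakly hyperbolic, so \<open>(\<theta>, \<rho> \<theta>)\<close> has no
  evident \<open>m\<close>-th preimage on the graph. It is however the limit of the points
  \<open>F\<^sup>m (\<sigma>\<^sup>-\<^sup>m \<theta>, a)\<close> for any \<open>a\<close> in \<open>closure A\<close>, and the iterated images are closed.
\<close>

lemma coding_graph_subset_iterated_image:
  "\<Gamma> \<subseteq> (F ^^ n) ` (full_shift k \<times> closure A)"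
proof
  fix z assume "z \<in> \<Gamma>"
  then obtain \<theta> where \<theta>: "\<theta> \<in> S" "z = (\<theta>, \<rho> \<theta>)"
    by (auto simp: coding_graph_def)
  obtain a where a: "a \<in> closure A" "a \<in> M"
  proof -
    obtain \<eta> where \<eta>: "\<eta> \<in> S"
      using nonempty by blast
    then have "\<rho> \<eta> \<in> closure A"
      using closure_subset[of A] by (auto simp: target_set_def)
    with that coding_map_in_M[OF \<eta>] show ?thesis
      by blast
  qed
  have approx: "(\<theta>, past_comp f \<theta> (m + n) a) \<in> (F ^^ n) ` (full_shift k \<times> closure A)" for m
  proof -
    have "(\<lambda>i. \<theta> (i - int (m + n))) \<in> full_shift k"
      using weakly_hyperbolic_full_shift[OF \<theta>(1)] by (simp add: full_shift_def)
    then have "(F ^^ (m + n)) ((\<lambda>i. \<theta> (i - int (m + n))), a) \<in> (F ^^ (m + n)) ` (full_shift k \<times> closure A)"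
      by (intro imageI SigmaI a)
    then show ?thesis
      unfolding skew_product_funpow_backward
      by (rule subsetD[OF funpow_image_antimono[OF skew_product_target_invariant le_add2]])
  qed
  have "(\<lambda>m. past_comp f \<theta> (m + n) a) \<longlonglongrightarrow> \<rho> \<theta>"
    using coding_map_tendsto[OF \<theta>(1) a(2)] by (rule LIMSEQ_ignore_initial_segment)
  then have "(\<lambda>m. (\<theta>, past_comp f \<theta> (m + n) a)) \<longlonglongrightarrow> (\<theta>, \<rho> \<theta>)"
    by (intro tendsto_intros)
  then show "z \<in> (F ^^ n) ` (full_shift k \<times> closure A)"
    unfolding \<theta>(2) by (rule closed_sequentially[OF closed_iterated_image_target approx])
qed

text \<open>
  A point \<open>(\<theta>, x)\<close> of the attractor has \<open>x\<close> in the image of \<open>closure A\<close> under the composition along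
  each finite past of \<open>\<theta>\<close>; replacing the remote past of \<open>\<theta>\<close> by a weakly hyperbolic one gives a
  nearby point of \<open>\<Gamma>\<close>.
\<close>

theorem maximal_attractor_eq_closure_coding_graph:
  "(\<Inter>n. (F ^^ n) ` (full_shift k \<times> closure A)) = closure \<Gamma>"
proof
  show "closure \<Gamma> \<subseteq> (\<Inter>n. (F ^^ n) ` (full_shift k \<times> closure A))"
    by (intro INT_greatest closure_minimal coding_graph_subset_iterated_image
        closed_iterated_image_target)
next
  show "(\<Inter>n. (F ^^ n) ` (full_shift k \<times> closure A)) \<subseteq> closure \<Gamma>"
  proof
    fix z assume z: "z \<in> (\<Inter>n. (F ^^ n) ` (full_shift k \<times> closure A))"
    obtain \<theta> x where zx: "z = (\<theta>, x)"
      by (cases z)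
    have "z \<in> (F ^^ 0) ` (full_shift k \<times> closure A)"
      using z by blast
    then have \<theta>: "\<theta> \<in> full_shift k"
      by (simp add: zx)
    show "z \<in> closure \<Gamma>"
      unfolding in_closure_iff_open
    proof (intro allI impI)
      fix W assume W: "open W \<and> z \<in> W"
      then have "open W" "(\<theta>, x) \<in> W"
        by (simp_all add: zx)
      then obtain n V where V: "open V" "x \<in> V" "cylinder \<theta> n \<times> V \<subseteq> W"
        by (rule open_Times_contains_cylinder)
      have "z \<in> (F ^^ n) ` (full_shift k \<times> closure A)"
        using z by blast
      then obtain \<theta>' b where b: "\<theta>' \<in> full_shift k" "b \<in> closure A" "(\<theta>, x) = (F ^^ n) (\<theta>', b)"
        by (auto simp: zx)
      then have x: "x = past_comp f \<theta> n b"
        by (simp add: skew_product_funpow)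
      obtain T where T: "open T" "T \<inter> M = past_comp f \<theta> n -` V \<inter> M"
        using past_comp_continuous[OF \<theta>] V(1) unfolding continuous_on_open_invariant by metis
      have "b \<in> T"
        using T(2) V(2) x b(2) closure_target_set_subset by blast
      then obtain \<eta> where \<eta>: "\<eta> \<in> S" "\<rho> \<eta> \<in> T"
        using b(2) T(1) unfolding in_closure_iff_open target_set_def by blast
      define \<zeta> where "\<zeta> = (\<lambda>i. if i < - int n then \<eta> (i + int n) else \<theta> i)"
      have "\<zeta> \<in> full_shift k"
        using \<theta> weakly_hyperbolic_full_shift[OF \<eta>(1)] by (auto simp: \<zeta>_def full_shift_def)
      then have \<zeta>: "\<zeta> \<in> S \<and> \<rho> \<zeta> = past_comp f \<zeta> n (\<rho> \<eta>)"
        using \<eta>(1) by (intro coding_map_prepend) (auto simp: \<zeta>_def)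
      have near: "\<zeta> \<in> cylinder \<theta> n"
        by (auto simp: cylinder_def \<zeta>_def)
      have "past_comp f \<theta> n (\<rho> \<eta>) \<in> V"
        using T(2) \<eta>(2) coding_map_in_M[OF \<eta>(1)] by blast
      then have "(\<zeta>, \<rho> \<zeta>) \<in> W"
        using \<zeta> V(3) near past_comp_cylinder[OF near, where f = f] by auto
      then show "\<Gamma> \<inter> W \<noteq> {}"
        using \<zeta> unfolding coding_graph_def by blast
    qed
  qed
qed


section \<open>Orbits of disjunctive points\<close>

lemma disjunctive_visits:
  assumes "z \<in> full_shift k \<times> M" "disjunctive k (fst z)" "open W" "W \<inter> \<Gamma> \<noteq> {}"
  shows "\<exists>m\<ge>L. (F ^^ m) z \<in> W"
proof -
  obtain \<eta> where \<eta>: "\<eta> \<in> S" "(\<eta>, \<rho> \<eta>) \<in> W"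
    using assms(4) by (auto simp: coding_graph_def)
  obtain n where n: "\<And>\<theta> x m. \<theta> \<in> full_shift k \<Longrightarrow> x \<in> M \<Longrightarrow> n \<le> m \<Longrightarrow>
       (\<lambda>i. \<theta> (i + int m)) \<in> cylinder \<eta> n \<Longrightarrow> (F ^^ m) (\<theta>, x) \<in> W"
    using orbit_near_coding_graph[OF \<eta>(1) assms(3) \<eta>(2)] by blast
  obtain m where "m \<ge> max n L" "(\<lambda>i. fst z (i + int m)) \<in> cylinder \<eta> n"
    using disjunctive_visits_cylinder[OF assms(2) weakly_hyperbolic_full_shift[OF \<eta>(1)]] by blast
  then show ?thesis
    using n[of "fst z" "snd z" m] assms(1) by auto
qed

lemma coding_graph_subset_omega_limit:
  assumes "z \<in> full_shift k \<times> M" "disjunctive k (fst z)"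
  shows "closure \<Gamma> \<subseteq> omega_limit F z"
proof
  fix w assume w: "w \<in> closure \<Gamma>"
  show "w \<in> omega_limit F z"
    unfolding omega_limit_iff_frequently
  proof (intro allI impI)
    fix W N assume "open W \<and> w \<in> W"
    then have "open W" "W \<inter> \<Gamma> \<noteq> {}"
      using w unfolding in_closure_iff_open by blast+
    then show "\<exists>m\<ge>N. (F ^^ m) z \<in> W"
      using disjunctive_visits[OF assms] by blast
  qed
qed

text \<open>
  What both sufficient conditions for equality have in common: they trap the orbit near
  \<open>closure A\<close>. Strong invariance then places the \<open>\<omega>\<close>-limit set in the maximal attractor.
\<close>

lemma omega_limit_subset_coding_graph:
  assumes z: "z \<in> full_shift k \<times> M"
    and trapped: "\<And>V. openin (top_of_set M) V \<Longrightarrow> closure A \<subseteq> V \<Longrightarrow>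
      \<exists>N. \<forall>m\<ge>N. snd ((F ^^ m) z) \<in> V"
  shows "omega_limit F z \<subseteq> closure \<Gamma>"
proof -
  have target: "u \<in> full_shift k \<times> closure A" if u: "u \<in> omega_limit F z" "u \<in> full_shift k \<times> M" for u
  proof (rule ccontr)
    assume "u \<notin> full_shift k \<times> closure A"
    then have "snd u \<notin> closure A"
      using u(2) by auto
    then obtain e where e: "e > 0" "cball (snd u) e \<subseteq> - closure A"
      using open_contains_cball[of "- closure A"] by auto
    define U V where "U = ball (snd u) e" and "V = - cball (snd u) e"
    have UV: "open U" "open V" "snd u \<in> U" "closure A \<subseteq> V" "U \<inter> V = {}"
      using e unfolding U_def V_def by auto
    have "openin (top_of_set M) (M \<inter> V)" "closure A \<subseteq> M \<inter> V"
      using UV closure_target_set_subset by (auto simp: openin_open_Int)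
    then obtain N where N: "\<forall>m\<ge>N. snd ((F ^^ m) z) \<in> M \<inter> V"
      using trapped by meson
    have "open (UNIV \<times> U :: ((int \<Rightarrow> nat) \<times> 'a) set)" "u \<in> UNIV \<times> U"
      using UV by (auto simp: open_Times mem_Times_iff)
    then obtain m where "m \<ge> N" "(F ^^ m) z \<in> UNIV \<times> U"
      using u(1) unfolding omega_limit_iff_frequently by meson
    with N UV(5) show False
      by (auto simp: mem_Times_iff)
  qed
  have "w \<in> (F ^^ n) ` (full_shift k \<times> closure A)" if w: "w \<in> omega_limit F z" for w n
  proof -
    obtain u where "u \<in> omega_limit F z" "u \<in> full_shift k \<times> M" "(F ^^ n) u = w"
      using omega_limit_backward[OF compact_phase_space skew_product_continuous
          skew_product_self_map z w] by blast
    then show ?thesis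
      using target by (intro image_eqI[of w _ u]) simp_all
  qed
  then show ?thesis
    unfolding maximal_attractor_eq_closure_coding_graph[symmetric] by (intro subsetI INT_I)
qed

lemma disjunctive_enters:
  assumes z: "z \<in> full_shift k \<times> M" "disjunctive k (fst z)"
    and U: "openin (top_of_set M) U" "U \<inter> A \<noteq> {}"
  shows "\<exists>m. snd ((F ^^ m) z) \<in> U"
proof -
  obtain T where T: "open T" "U = M \<inter> T"
    using U(1) by (auto simp: openin_open)
  have "open (UNIV \<times> T :: ((int \<Rightarrow> nat) \<times> 'a) set)"
    using T by (simp add: open_Times)
  moreover have "(UNIV \<times> T) \<inter> \<Gamma> \<noteq> {}"
    using U(2) T by (auto simp: target_set_def coding_graph_def)
  ultimately obtain m where "(F ^^ m) z \<in> UNIV \<times> T"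
    using disjunctive_visits[OF z, of "UNIV \<times> T"] by meson
  moreover have "(F ^^ m) z \<in> full_shift k \<times> M"
    using funpow_invariant[OF skew_product_self_map z(1)] .
  ultimately show ?thesis
    using T by (auto simp: mem_Times_iff)
qed

lemma barnsley_hutchinson_orbit:
  assumes "z \<in> full_shift k \<times> V"
  shows "(F ^^ n) z \<in> full_shift k \<times> (barnsley_hutchinson k f ^^ n) V"
proof (induction n)
  case (Suc n)
  then show ?case
    by (cases "(F ^^ n) z")
      (force simp: skew_product_def left_shift_def full_shift_def barnsley_hutchinson_def)
qed (simp add: assms)

lemma funpow_from: "m \<le> n \<Longrightarrow> (F ^^ n) z = (F ^^ (n - m)) ((F ^^ m) z)"
  by (metis comp_apply funpow_add le_add_diff_inverse2)

text \<open>
  Both hypotheses provide an open set that meets the target set and from which orbits cannot leave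
  the given neighbourhood \<open>V\<close> of \<open>closure A\<close>: the set \<open>V0\<close> of Lyapunov stability in one case, the
  interior of \<open>closure A\<close> in the other. A disjunctive orbit enters every open set of this kind.
\<close>

theorem omega_limit_eq_closure_coding_graph:
  assumes z: "z \<in> full_shift k \<times> M" "disjunctive k (fst z)"
    and "lyapunov_stable_fixed_point M (barnsley_hutchinson k f) (closure A)
      \<or> (top_of_set M) interior_of (closure A) \<noteq> {}"
  shows "closure \<Gamma> = omega_limit F z"
proof (rule antisym)
  show "closure \<Gamma> \<subseteq> omega_limit F z"
    by (rule coding_graph_subset_omega_limit[OF z])
  have orbit: "(F ^^ m) z \<in> full_shift k \<times> M" for m
    using funpow_invariant[OF skew_product_self_map z(1)] .
  have "A \<noteq> {}"
    using nonempty by (auto simp: target_set_def)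
  from assms(3) have "\<exists>N. \<forall>m\<ge>N. snd ((F ^^ m) z) \<in> V"
    if V: "openin (top_of_set M) V" "closure A \<subseteq> V" for V
  proof
    assume "lyapunov_stable_fixed_point M (barnsley_hutchinson k f) (closure A)"
    then obtain V0 where V0: "openin (top_of_set M) V0" "closure A \<subseteq> V0"
        "\<And>n. (barnsley_hutchinson k f ^^ n) V0 \<subseteq> V"
      unfolding lyapunov_stable_fixed_point_def using V by meson
    have "V0 \<inter> A \<noteq> {}"
      using V0(2) closure_subset \<open>A \<noteq> {}\<close> by blast
    then obtain N where "snd ((F ^^ N) z) \<in> V0"
      using disjunctive_enters[OF z V0(1)] by blast
    then have N: "(F ^^ N) z \<in> full_shift k \<times> V0"
      using orbit[of N] by (auto simp: mem_Times_iff)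
    have "snd ((F ^^ m) z) \<in> V" if "m \<ge> N" for m
      using barnsley_hutchinson_orbit[OF N, of "m - N"] V0(3)[of "m - N"]
      unfolding funpow_from[OF that] mem_Times_iff by blast
    then show ?thesis
      by blast
  next
    let ?U = "(top_of_set M) interior_of (closure A)"
    assume "?U \<noteq> {}"
    have U: "openin (top_of_set M) ?U" "?U \<subseteq> closure A"
      by (auto simp: interior_of_subset)
    obtain T where T: "open T" "?U = M \<inter> T"
      using U(1) unfolding openin_open by metis
    have "T \<inter> closure A \<noteq> {}"
      using U(2) T(2) \<open>?U \<noteq> {}\<close> by fast
    then have "T \<inter> A \<noteq> {}"
      using open_Int_closure_eq_empty[OF T(1)] by simp
    moreover have "A \<subseteq> M"
      using closure_subset closure_target_set_subset by (rule subset_trans)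
    ultimately have "?U \<inter> A \<noteq> {}"
      unfolding T(2) by blast
    then obtain N where "snd ((F ^^ N) z) \<in> ?U"
      using disjunctive_enters[OF z U(1)] by blast
    then have "(F ^^ N) z \<in> full_shift k \<times> closure A"
      using orbit[of N] U(2) by (auto simp: mem_Times_iff)
    then have "(F ^^ m) z \<in> full_shift k \<times> closure A" if "m \<ge> N" for m
      unfolding funpow_from[OF that] by (rule funpow_invariant[OF skew_product_target_invariant])
    then show ?thesis
      using V(2) by (auto simp: mem_Times_iff)
  qed
  then show "omega_limit F z \<subseteq> closure \<Gamma>"
    by (rule omega_limit_subset_coding_graph[OF z(1)])
qed


section \<open>Mixing\<close>

text \<open>
  The value \<open>\<rho> \<eta>\<close> does not change with the future of \<open>\<eta>\<close>, which can therefore be made to spell, at any sufficiently late time, a long word of any other \<open>\<xi> \<in> S\<close>.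
\<close>

theorem topologically_mixing_closure_coding_graph: "topologically_mixing_in F (closure \<Gamma>)"
  unfolding topologically_mixing_in_def
proof (intro conjI allI impI)
  show "compact (closure \<Gamma>)"
    using closed_Int_compact[OF closed_closure compact_phase_space, of \<Gamma>] closure_coding_graph_subset
    by (simp add: Int_absorb2)
  show "F ` closure \<Gamma> \<subseteq> closure \<Gamma>"
    by (rule closure_coding_graph_invariant)
  fix U V
  assume "openin (top_of_set (closure \<Gamma>)) U \<and> U \<noteq> {} \<and> openin (top_of_set (closure \<Gamma>)) V \<and> V \<noteq> {}"
  then obtain U' V' where U': "open U'" "U = closure \<Gamma> \<inter> U'" "U \<noteq> {}"
      and V': "open V'" "V = closure \<Gamma> \<inter> V'" "V \<noteq> {}"
    by (auto simp: openin_open)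
  have "U' \<inter> \<Gamma> \<noteq> {}" "V' \<inter> \<Gamma> \<noteq> {}"
    using U' V' open_Int_closure_eq_empty by blast+
  then obtain \<xi> \<eta> where \<xi>: "\<xi> \<in> S" "(\<xi>, \<rho> \<xi>) \<in> U'" and \<eta>: "\<eta> \<in> S" "(\<eta>, \<rho> \<eta>) \<in> V'"
    by (auto simp: coding_graph_def)
  obtain n where n: "\<And>\<theta> x m. \<theta> \<in> full_shift k \<Longrightarrow> x \<in> M \<Longrightarrow> n \<le> m \<Longrightarrow>
       (\<lambda>i. \<theta> (i + int m)) \<in> cylinder \<xi> n \<Longrightarrow> (F ^^ m) (\<theta>, x) \<in> U'"
    using orbit_near_coding_graph[OF \<xi>(1) U'(1) \<xi>(2)] by blast
  obtain l B where B: "open B" "\<rho> \<eta> \<in> B" "cylinder \<eta> l \<times> B \<subseteq> V'"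
    using open_Times_contains_cylinder[OF V'(1) \<eta>(2)] .
  have "(F ^^ m) ` V \<inter> U \<noteq> {}" if m: "m > l + n" for m
  proof -
    \<comment> \<open>The block of \<open>\<xi>\<close> occupies the places \<open>m - n\<close> to \<open>m + n\<close>; the bound on \<open>m\<close> keeps it clear of
      the word of \<open>\<eta>\<close>, which ends at \<open>l\<close>.\<close>
    define \<zeta> where "\<zeta> = (\<lambda>i. if i \<le> int l then \<eta> i else \<xi> (i - int m))"
    have fs: "\<zeta> \<in> full_shift k"
      using weakly_hyperbolic_full_shift[OF \<eta>(1)] weakly_hyperbolic_full_shift[OF \<xi>(1)]
      by (auto simp: \<zeta>_def full_shift_def)
    then have \<zeta>: "\<zeta> \<in> S" "\<rho> \<zeta> = \<rho> \<eta>"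
      using coding_map_same_past[OF \<eta>(1) fs] by (auto simp: \<zeta>_def)
    have graph: "(\<zeta>, \<rho> \<eta>) \<in> \<Gamma>"
      using \<zeta> by (force simp: coding_graph_def)
    have "\<zeta> \<in> cylinder \<eta> l"
      by (auto simp: cylinder_def \<zeta>_def)
    then have "(\<zeta>, \<rho> \<eta>) \<in> V"
      using B V'(2) graph closure_subset by blast
    moreover have "(\<lambda>i. \<zeta> (i + int m)) \<in> cylinder \<xi> n"
      using m by (auto simp: cylinder_def \<zeta>_def)
    then have "(F ^^ m) (\<zeta>, \<rho> \<eta>) \<in> U'"
      using n[OF fs coding_map_in_M[OF \<eta>(1)]] m by simp
    moreover have "(F ^^ m) (\<zeta>, \<rho> \<eta>) \<in> closure \<Gamma>"
      using funpow_invariant[OF coding_graph_invariant graph] closure_subset by blast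
    ultimately show ?thesis
      using U'(2) by blast
  qed
  then show "\<exists>n0. \<forall>m\<ge>n0. (F ^^ m) ` V \<inter> U \<noteq> {}"
    by (intro exI[of _ "Suc (l + n)"]) auto
qed

end

theorem theorem1:
  fixes M :: "'a::metric_space set" and f :: "nat \<Rightarrow> 'a \<Rightarrow> 'a" and k :: nat
  assumes "compact M"
    and "\<And>i. i \<in> {1..k} \<Longrightarrow> continuous_on M (f i)"
    and "\<And>i. i \<in> {1..k} \<Longrightarrow> f i ` M \<subseteq> M"
    and "weakly_hyperbolic k M f \<noteq> {}"
  shows
    "(\<forall>z \<in> full_shift k \<times> M. disjunctive k (fst z) \<longrightarrow>
        closure (coding_graph k M f) \<subseteq> omega_limit (skew_product f) z)
     \<and> (lyapunov_stable_fixed_point M (barnsley_hutchinson k f) (closure (target_set k M f))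
         \<or> (top_of_set M) interior_of (closure (target_set k M f)) \<noteq> {}
        \<longrightarrow> (\<forall>z \<in> full_shift k \<times> M. disjunctive k (fst z) \<longrightarrow>
              closure (coding_graph k M f) = omega_limit (skew_product f) z))
     \<and> maximal_attractor
          (restrict (skew_product f) (full_shift k \<times> closure (target_set k M f)))
          (full_shift k \<times> closure (target_set k M f))
        = closure (coding_graph k M f)
     \<and> topologically_mixing_in (skew_product f) (closure (coding_graph k M f))"
proof -
  interpret step_skew_product k M f
    using assms by unfold_locales auto
  have attractor: "maximal_attractor (restrict F (full_shift k \<times> closure A)) (full_shift k \<times> closure A)
      = closure \<Gamma>"
    unfolding maximal_attractor_def funpow_restrict_image[OF skew_product_target_invariant]
    by (rule maximal_attractor_eq_closure_coding_graph)
  show ?thesis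
    by (intro conjI ballI impI coding_graph_subset_omega_limit omega_limit_eq_closure_coding_graph
        attractor topologically_mixing_closure_coding_graph)
qed

end
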